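(* Let $G$ be a group, let $A$ and $B$ be proper isomorphic subgroups of $G$, and let $\phi: A \to B$ be an isomorphism. Then the HNN extension $$G_{\ast} = \langle G, t \mid t^{-1} a t = \phi(a),\ a \in A \rangle$$ of $G$ with associated subgroups $A$ and $B$ has infinite palindromic width with respect to the generating set $G \cup \{t, t^{-1}\}$. That is, $pw(G_\ast, G \cup \{t,t^{-1}\}) = \infty$.
   Context: Reduced words: a sequence $g_0, t^{\epsilon_1}, g_1, \ldots, t^{\epsilon_n}, g_n$ ($n \ge 0$, $g_i \in G$, $\epsilon_i \in \{1,-1\}$) is reduced if it contains no subsequence of consecutive terms of the form $t^{-1}, g_i, t$ with $g_i \in A$ or $t, g_i, t^{-1}$ with $g_i \in B$. The corresponding expression $g_0 t^{\epsilon_1} g_1 \cdots t^{\epsilon_n} g_n$ is called a reduced word. Every element of $G_\ast$ is represented by some reduced word. A palindrome in $G_\ast$ with respect to the generating set $G\cup\{t,t^{-1}\}$ is a reduced word $g_0 t^{\epsilon_1} g_1 \cdots t^{\epsilon_n} g_n$ which reads the same forward and backward, i.e. $g_i = g_{n-i}$ for $0 \le i \le n$ and $\epsilon_i = \epsilon_{n+1-i}$ for $1 \le i \le n$. An element of $G_\ast$ represented by such a word is also called a palindrome. The palindromic length $l_{\mathcal P}(g)$ of $g \in G_\ast$ is the minimum number $k$ such that $g$ is a product of $k$ palindromes. The palindromic width is $pw(G_\ast, G\cup\{t,t^{-1}\}) = \sup_{g \in G_\ast} l_{\mathcal P}(g)$. *)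

theory Defs
  imports "HOL-Algebra.Group" "HOL-Library.Extended_Nat"
begin

text \<open>
  \<open>Base g\<close> is the letter \<open>g \<in> G\<close>, and \<open>Stable e\<close> is the letter \<open>t\<^sup>e\<close> with \<open>e\<close> either \<open>1\<close> or \<open>-1\<close>.
\<close>

datatype 'a hnn_letter = Base 'a | Stable int

definition hnn_words :: "('a, 'b) monoid_scheme \<Rightarrow> 'a hnn_letter list set" where
  "hnn_words G = lists (Base ` carrier G \<union> Stable ` {1, -1})"

text \<open>
  The congruence on words presenting \<open>\<langle>G, t | t\<^sup>-\<^sup>1 a t = \<phi> a, a \<in> A\<rangle>\<close>: \<open>mult\<close> and \<open>one\<close> impose the
  multiplication table of \<open>G\<close>, \<open>cancel\<close> makes \<open>t\<close> and \<open>t\<^sup>-\<^sup>1\<close> mutually inverse, and \<open>conj\<close> gives the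
  defining relations. Every letter thereby becomes invertible, so the quotient monoid is the
  presented group.
\<close>

inductive hnn_eq ::
  "('a, 'b) monoid_scheme \<Rightarrow> 'a set \<Rightarrow> ('a \<Rightarrow> 'a) \<Rightarrow> 'a hnn_letter list \<Rightarrow> 'a hnn_letter list \<Rightarrow> bool"
  for G :: "('a, 'b) monoid_scheme" and A :: "'a set" and \<phi> :: "'a \<Rightarrow> 'a" where
  refl: "w \<in> hnn_words G \<Longrightarrow> hnn_eq G A \<phi> w w"
| sym: "hnn_eq G A \<phi> v w \<Longrightarrow> hnn_eq G A \<phi> w v"
| trans: "hnn_eq G A \<phi> u v \<Longrightarrow> hnn_eq G A \<phi> v w \<Longrightarrow> hnn_eq G A \<phi> u w"
| append: "hnn_eq G A \<phi> u u' \<Longrightarrow> hnn_eq G A \<phi> v v' \<Longrightarrow> hnn_eq G A \<phi> (u @ v) (u' @ v')"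
| mult: "g \<in> carrier G \<Longrightarrow> h \<in> carrier G \<Longrightarrow> hnn_eq G A \<phi> [Base g, Base h] [Base (g \<otimes>\<^bsub>G\<^esub> h)]"
| one: "hnn_eq G A \<phi> [Base \<one>\<^bsub>G\<^esub>] []"
| cancel: "e \<in> {1, -1} \<Longrightarrow> hnn_eq G A \<phi> [Stable e, Stable (- e)] []"
| conj: "a \<in> A \<Longrightarrow> hnn_eq G A \<phi> [Stable (-1), Base a, Stable 1] [Base (\<phi> a)]"

definition hnn_class ::
  "('a, 'b) monoid_scheme \<Rightarrow> 'a set \<Rightarrow> ('a \<Rightarrow> 'a) \<Rightarrow> 'a hnn_letter list \<Rightarrow> 'a hnn_letter list set" where
  "hnn_class G A \<phi> w = {v. hnn_eq G A \<phi> w v}"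

definition hnn_extension ::
  "('a, 'b) monoid_scheme \<Rightarrow> 'a set \<Rightarrow> ('a \<Rightarrow> 'a) \<Rightarrow> 'a hnn_letter list set monoid" where
  "hnn_extension G A \<phi> =
    \<lparr>carrier = hnn_class G A \<phi> ` hnn_words G,
     mult = (\<lambda>X Y. \<Union>x\<in>X. \<Union>y\<in>Y. hnn_class G A \<phi> (x @ y)),
     one = hnn_class G A \<phi> []\<rparr>"

text \<open>
  The sequence \<open>g\<^sub>0, t\<^bsup>\<epsilon>\<^sub>1\<^esup>, g\<^sub>1, \<dots>, t\<^bsup>\<epsilon>\<^sub>n\<^esup>, g\<^sub>n\<close> is given by the lists \<open>gs = [g\<^sub>0, \<dots>, g\<^sub>n]\<close> and
  \<open>es = [\<epsilon>\<^sub>1, \<dots>, \<epsilon>\<^sub>n]\<close>. Lists are indexed from \<open>0\<close>, so \<open>\<epsilon>\<^sub>i = es ! (i - 1)\<close>, and \<open>gs ! Suc i\<close> stands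
  between \<open>es ! i\<close> and \<open>es ! Suc i\<close>.
\<close>

definition hnn_word :: "'a list \<Rightarrow> int list \<Rightarrow> 'a hnn_letter list" where
  "hnn_word gs es = Base (hd gs) # concat (map2 (\<lambda>e g. [Stable e, Base g]) es (tl gs))"

definition hnn_reduced ::
  "('a, 'b) monoid_scheme \<Rightarrow> 'a set \<Rightarrow> 'a set \<Rightarrow> 'a list \<Rightarrow> int list \<Rightarrow> bool" where
  "hnn_reduced G A B gs es \<longleftrightarrow>
    length gs = Suc (length es) \<and> set gs \<subseteq> carrier G \<and> set es \<subseteq> {1, -1} \<and>
    (\<forall>i. Suc i < length es \<longrightarrow>
      \<not> (es ! i = -1 \<and> gs ! Suc i \<in> A \<and> es ! Suc i = 1) \<and>
      \<not> (es ! i = 1 \<and> gs ! Suc i \<in> B \<and> es ! Suc i = -1))"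

definition hnn_palindromes ::
  "('a, 'b) monoid_scheme \<Rightarrow> 'a set \<Rightarrow> 'a set \<Rightarrow> ('a \<Rightarrow> 'a) \<Rightarrow> 'a hnn_letter list set set" where
  "hnn_palindromes G A B \<phi> =
    {hnn_class G A \<phi> (hnn_word gs es) | gs es.
      hnn_reduced G A B gs es \<and> rev gs = gs \<and> rev es = es}"

definition hnn_palindromic_length ::
  "('a, 'b) monoid_scheme \<Rightarrow> 'a set \<Rightarrow> 'a set \<Rightarrow> ('a \<Rightarrow> 'a) \<Rightarrow> 'a hnn_letter list set \<Rightarrow> nat" where
  "hnn_palindromic_length G A B \<phi> x =
    (LEAST k. \<exists>ps. length ps = k \<and> set ps \<subseteq> hnn_palindromes G A B \<phi> \<and>
      x = foldr (\<lambda>p q. p \<otimes>\<^bsub>hnn_extension G A \<phi>\<^esub> q) ps \<one>\<^bsub>hnn_extension G A \<phi>\<^esub>)"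

definition hnn_palindromic_width ::
  "('a, 'b) monoid_scheme \<Rightarrow> 'a set \<Rightarrow> 'a set \<Rightarrow> ('a \<Rightarrow> 'a) \<Rightarrow> enat" where
  "hnn_palindromic_width G A B \<phi> =
    (SUP x\<in>carrier (hnn_extension G A \<phi>). enat (hnn_palindromic_length G A B \<phi> x))"

context
  fixes G :: "('a, 'b) monoid_scheme" (structure) and A B :: "'a set" and \<phi> :: "'a \<Rightarrow> 'a"
  assumes G: "group G" and A: "subgroup A G"
    and \<phi>: "\<phi> ` A \<subseteq> carrier G"
begin

interpretation group G by (rule G)

lemma hnn_words_append: "u @ v \<in> hnn_words G \<longleftrightarrow> u \<in> hnn_words G \<and> v \<in> hnn_words G"
  by (auto simp: hnn_words_def)

lemma hnn_eq_words: "hnn_eq G A \<phi> u v \<Longrightarrow> u \<in> hnn_words G \<and> v \<in> hnn_words G"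
proof (induction rule: hnn_eq.induct)
  case (conj a)
  then have "a \<in> carrier G" "\<phi> a \<in> carrier G" using A \<phi> subgroup.subset by blast+
  then show ?case by (auto simp: hnn_words_def)
qed (auto simp: hnn_words_def)

lemma hnn_class_eq_iff:
  assumes "u \<in> hnn_words G"
  shows "hnn_class G A \<phi> u = hnn_class G A \<phi> v \<longleftrightarrow> hnn_eq G A \<phi> u v"
proof
  assume "hnn_class G A \<phi> u = hnn_class G A \<phi> v"
  then have "hnn_eq G A \<phi> v u"
    using hnn_eq.refl[OF assms, of A \<phi>] unfolding hnn_class_def by blast
  then show "hnn_eq G A \<phi> u v" by (rule hnn_eq.sym)
next
  assume uv: "hnn_eq G A \<phi> u v"
  show "hnn_class G A \<phi> u = hnn_class G A \<phi> v"
    unfolding hnn_class_def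
    using hnn_eq.trans[OF uv] hnn_eq.trans[OF hnn_eq.sym[OF uv]] by blast
qed

lemma hnn_mult_class:
  assumes "u \<in> hnn_words G" "v \<in> hnn_words G"
  shows "hnn_class G A \<phi> u \<otimes>\<^bsub>hnn_extension G A \<phi>\<^esub> hnn_class G A \<phi> v = hnn_class G A \<phi> (u @ v)"
proof -
  have *: "hnn_class G A \<phi> (x @ y) = hnn_class G A \<phi> (u @ v)"
    if "x \<in> hnn_class G A \<phi> u" "y \<in> hnn_class G A \<phi> v" for x y
  proof -
    have "hnn_eq G A \<phi> (u @ v) (x @ y)"
      using that by (simp add: hnn_class_def hnn_eq.append)
    then show ?thesis
      using assms hnn_class_eq_iff[of "u @ v" "x @ y"] by (simp add: hnn_words_append)
  qed
  have uv: "u \<in> hnn_class G A \<phi> u" "v \<in> hnn_class G A \<phi> v"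
    using assms by (simp_all add: hnn_class_def hnn_eq.refl)
  have "(\<Union>x\<in>hnn_class G A \<phi> u. \<Union>y\<in>hnn_class G A \<phi> v. hnn_class G A \<phi> (x @ y)) =
      (\<Union>x\<in>hnn_class G A \<phi> u. \<Union>y\<in>hnn_class G A \<phi> v. hnn_class G A \<phi> (u @ v))"
    by (intro SUP_cong *) (rule HOL.refl)+
  also have "\<dots> = hnn_class G A \<phi> (u @ v)"
    using uv by blast
  finally show ?thesis by (simp add: hnn_extension_def)
qed

lemma hnn_letter_inverse:
  assumes "x \<in> Base ` carrier G \<union> Stable ` {1, -1}"
  shows "\<exists>y \<in> Base ` carrier G \<union> Stable ` {1, -1}. hnn_eq G A \<phi> [y, x] []"
  using assms
proof (elim UnE imageE)
  fix g assume g: "x = Base g" "g \<in> carrier G"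
  have "hnn_eq G A \<phi> [Base (inv g), Base g] [Base \<one>]"
    using hnn_eq.mult[of "inv g" G g A \<phi>] g by simp
  then have "hnn_eq G A \<phi> [Base (inv g), x] []"
    unfolding g(1) by (rule hnn_eq.trans) (rule hnn_eq.one)
  then show ?thesis using g by blast
next
  fix e :: int assume e: "x = Stable e" "e \<in> {1, -1}"
  have "hnn_eq G A \<phi> [Stable (- e), x] []"
    using hnn_eq.cancel[of "- e" G A \<phi>] e by auto
  then show ?thesis using e by (intro bexI[of _ "Stable (- e)"]) auto
qed

lemma hnn_word_inverse:
  "w \<in> hnn_words G \<Longrightarrow> \<exists>v \<in> hnn_words G. hnn_eq G A \<phi> (v @ w) []"
proof (induction w)
  case Nil
  then show ?case using hnn_eq.refl[of "[]" G A \<phi>] by (intro bexI[of _ "[]"]) auto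
next
  case (Cons x w)
  have x: "x \<in> Base ` carrier G \<union> Stable ` {1, -1}" and w: "w \<in> hnn_words G"
    using Cons.prems by (auto simp: hnn_words_def)
  obtain y where y: "y \<in> Base ` carrier G \<union> Stable ` {1, -1}" "hnn_eq G A \<phi> [y, x] []"
    using hnn_letter_inverse[OF x] by blast
  obtain v where v: "v \<in> hnn_words G" "hnn_eq G A \<phi> (v @ w) []"
    using Cons.IH[OF w] by blast
  have "hnn_eq G A \<phi> (v @ ([y, x] @ w)) (v @ ([] @ w))"
    by (intro hnn_eq.append hnn_eq.refl v w y)
  then have "hnn_eq G A \<phi> ((v @ [y]) @ x # w) []"
    using hnn_eq.trans[OF _ v(2)] by simp
  moreover have "v @ [y] \<in> hnn_words G"
    using v(1) y(1) by (auto simp: hnn_words_def)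
  ultimately show ?case by blast
qed

lemma group_hnn_extension: "group (hnn_extension G A \<phi>)"
proof (rule groupI)
  let ?H = "hnn_extension G A \<phi>"
  have carrier: "carrier ?H = hnn_class G A \<phi> ` hnn_words G"
    and one: "\<one>\<^bsub>?H\<^esub> = hnn_class G A \<phi> []"
    by (simp_all add: hnn_extension_def)
  have Nil: "[] \<in> hnn_words G" by (simp add: hnn_words_def)
  show "\<one>\<^bsub>?H\<^esub> \<in> carrier ?H" using Nil by (simp add: carrier one)
  show "x \<otimes>\<^bsub>?H\<^esub> y \<in> carrier ?H" if "x \<in> carrier ?H" "y \<in> carrier ?H" for x y
    using that by (auto simp: carrier hnn_mult_class hnn_words_append)
  show "x \<otimes>\<^bsub>?H\<^esub> y \<otimes>\<^bsub>?H\<^esub> z = x \<otimes>\<^bsub>?H\<^esub> (y \<otimes>\<^bsub>?H\<^esub> z)"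
    if "x \<in> carrier ?H" "y \<in> carrier ?H" "z \<in> carrier ?H" for x y z
    using that by (auto simp: carrier hnn_mult_class hnn_words_append)
  show "\<one>\<^bsub>?H\<^esub> \<otimes>\<^bsub>?H\<^esub> x = x" if "x \<in> carrier ?H" for x
    using that Nil by (auto simp: carrier one hnn_mult_class)
  show "\<exists>y\<in>carrier ?H. y \<otimes>\<^bsub>?H\<^esub> x = \<one>\<^bsub>?H\<^esub>" if x: "x \<in> carrier ?H" for x
  proof -
    obtain w where w: "w \<in> hnn_words G" "x = hnn_class G A \<phi> w"
      using x by (auto simp: carrier)
    obtain v where v: "v \<in> hnn_words G" "hnn_eq G A \<phi> (v @ w) []"
      using hnn_word_inverse[OF w(1)] by blast
    have "hnn_class G A \<phi> v \<otimes>\<^bsub>?H\<^esub> x = \<one>\<^bsub>?H\<^esub>"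
      using w v by (simp add: one hnn_mult_class hnn_class_eq_iff hnn_words_append)
    then show ?thesis using v(1) by (auto simp: carrier)
  qed
qed

lemma hnn_letter_palindrome:
  assumes "x \<in> Base ` carrier G \<union> Stable ` {1, -1}"
  shows "hnn_class G A \<phi> [x] \<in> hnn_palindromes G A B \<phi>"
  using assms
proof (elim UnE imageE)
  fix g assume g: "x = Base g" "g \<in> carrier G"
  have "[x] = hnn_word [g] []" "hnn_reduced G A B [g] []"
    using g by (auto simp: hnn_word_def hnn_reduced_def)
  then show ?thesis unfolding hnn_palindromes_def
    by (intro CollectI exI[of _ "[g]"] exI[of _ "[]"]) simp
next
  fix e :: int assume e: "x = Stable e" "e \<in> {1, -1}"
  have s: "[x] \<in> hnn_words G" using e by (auto simp: hnn_words_def)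
  have "hnn_eq G A \<phi> ([Base \<one>] @ [x] @ [Base \<one>]) ([] @ [x] @ [])"
    by (intro hnn_eq.append hnn_eq.one hnn_eq.refl s)
  then have "hnn_eq G A \<phi> [x] (hnn_word [\<one>, \<one>] [e])"
    unfolding e(1) by (intro hnn_eq.sym[of G A \<phi> "hnn_word [\<one>, \<one>] [e]"]) (simp add: hnn_word_def)
  then have "hnn_class G A \<phi> [x] = hnn_class G A \<phi> (hnn_word [\<one>, \<one>] [e])"
    using s hnn_class_eq_iff by blast
  moreover have "hnn_reduced G A B [\<one>, \<one>] [e]"
    using e by (auto simp: hnn_reduced_def)
  ultimately show ?thesis unfolding hnn_palindromes_def
    by (intro CollectI exI[of _ "[\<one>, \<one>]"] exI[of _ "[e]"]) simp
qed

text \<open>The minimum in the definition of the palindromic length is taken over a nonempty set.\<close>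

lemma hnn_palindromic_length_exists:
  assumes "x \<in> carrier (hnn_extension G A \<phi>)"
  shows "\<exists>k ps. length ps = k \<and> set ps \<subseteq> hnn_palindromes G A B \<phi> \<and>
    x = foldr (\<lambda>p q. p \<otimes>\<^bsub>hnn_extension G A \<phi>\<^esub> q) ps \<one>\<^bsub>hnn_extension G A \<phi>\<^esub>"
proof -
  let ?H = "hnn_extension G A \<phi>"
  have "hnn_class G A \<phi> w =
      foldr (\<lambda>p q. p \<otimes>\<^bsub>?H\<^esub> q) (map (\<lambda>x. hnn_class G A \<phi> [x]) w) \<one>\<^bsub>?H\<^esub>"
    if "w \<in> hnn_words G" for w
    using that
  proof (induction w)
    case Nil
    then show ?case by (simp add: hnn_extension_def)
  next
    case (Cons x w)
    then have "[x] \<in> hnn_words G" "w \<in> hnn_words G" by (auto simp: hnn_words_def)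
    then show ?case using Cons.IH hnn_mult_class[of "[x]" w] by simp
  qed
  moreover obtain w where w: "w \<in> hnn_words G" "x = hnn_class G A \<phi> w"
    using assms by (auto simp: hnn_extension_def)
  moreover have "set (map (\<lambda>x. hnn_class G A \<phi> [x]) w) \<subseteq> hnn_palindromes G A B \<phi>"
    using w(1) hnn_letter_palindrome by (auto simp: hnn_words_def in_lists_conv_set)
  ultimately show ?thesis by blast
qed

end

end

theory Submission
  imports Defs "HOL-Algebra.Coset" "HOL-Library.Sublist"
begin

text \<open>
  By Britton's lemma the exponent sequence of a reduced word depends only on the element it
  represents; we obtain this from the action of words on normal forms. When an element is multiplied
  on the left by a reduced word, a suffix \<open>x\<close> of the exponent sequence of the word cancels against a
  prefix \<open>- rev x\<close> of that of the element, and nothing else changes. Counting the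
  occurrences of a fixed word \<open>w\<close> and of \<open>- w\<close>, minus those of their reversals, gives a
  quasimorphism in the manner of Brooks which changes sign under reversal and is invariant under
  negation. It vanishes on palindromes, so it changes by a bounded amount when an element is
  multiplied by a palindrome. Since \<open>A\<close> and \<open>B\<close> are proper, every exponent sequence occurs, and
  for \<open>w = + - - + +\<close> the quasimorphism is unbounded.
\<close>

section \<open>Counting occurrences of a word\<close>

definition occurrences :: "'a list \<Rightarrow> 'a list \<Rightarrow> nat" where
  "occurrences w s = length (filter (prefix w) (suffixes s))"

lemma occurrences_Nil [simp]: "occurrences w [] = of_bool (w = [])"
  by (simp add: occurrences_def)

lemma occurrences_Cons [simp]:
  "occurrences w (x # s) = of_bool (prefix w (x # s)) + occurrences w s"
  by (simp add: occurrences_def)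

lemma occurrences_snoc:
  "occurrences w (s @ [x]) = occurrences w s + of_bool (suffix w (s @ [x]))"
proof (induction s)
  case (Cons y s)
  have "\<not> prefix (y # s @ [x]) (y # s)" "\<not> suffix (y # s @ [x]) (s @ [x])"
    by (auto dest: prefix_length_le suffix_length_le)
  then have "of_bool (prefix w (y # s @ [x])) + of_bool (suffix w (s @ [x])) =
      (of_bool (prefix w (y # s)) + of_bool (suffix w (y # s @ [x])) :: nat)"
    using prefix_snoc[of w "y # s" x] suffix_Cons[of w y "s @ [x]"] by auto
  with Cons show ?case by simp
qed (auto simp: suffix_Cons prefix_Cons)

lemma occurrences_rev: "occurrences (rev w) (rev s) = occurrences w s"
  by (induction s) (simp_all add: occurrences_snoc suffix_to_prefix)

lemma prefix_map_iff:
  assumes "inj f"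
  shows "prefix (map f u) (map f v) \<longleftrightarrow> prefix u v"
  using assms by (metis injD inj_map map_mono_prefix prefix_map_rightE)

lemma occurrences_map:
  assumes "inj f"
  shows "occurrences (map f w) (map f s) = occurrences w s"
proof (induction s)
  case (Cons x s)
  then show ?case using prefix_map_iff[OF assms, of w "x # s"] by simp
qed simp

lemma occurrences_append:
  assumes "w \<noteq> []"
  shows "occurrences w u + occurrences w v \<le> occurrences w (u @ v)"
    and "occurrences w (u @ v) \<le> occurrences w u + occurrences w v + length w"
proof -
  have "occurrences w u + occurrences w v \<le> occurrences w (u @ v) \<and>
    occurrences w (u @ v) \<le> occurrences w u + occurrences w v + min (length w) (length u)"
  proof (induction u)
    case (Cons x u)
    have "prefix w (x # u @ v)" if "prefix w (x # u)"
      using prefix_prefix[OF that] by simp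
    moreover have "prefix w (x # u)" if "prefix w (x # u @ v)" "length w \<le> length u"
      using that by (intro prefix_length_prefix[OF that(1)]) simp_all
    ultimately show ?case using Cons by (cases "length w \<le> length u") auto
  qed (use assms in simp)
  then show "occurrences w u + occurrences w v \<le> occurrences w (u @ v)"
    and "occurrences w (u @ v) \<le> occurrences w u + occurrences w v + length w" by auto
qed

section \<open>A quasimorphism vanishing on palindromes\<close>

definition chirality :: "'a::group_add list \<Rightarrow> 'a list \<Rightarrow> int" where
  "chirality w s = int (occurrences w s) + int (occurrences (map uminus w) s)
    - int (occurrences (rev w) s) - int (occurrences (rev (map uminus w)) s)"

lemma chirality_Nil [simp]: "chirality w [] = 0"
  by (simp add: chirality_def)

lemma chirality_rev: "chirality w (rev s) = - chirality w s"
  using occurrences_rev[of w s] occurrences_rev[of "rev w" s]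
    occurrences_rev[of "map uminus w" s] occurrences_rev[of "rev (map uminus w)" s]
  by (simp add: chirality_def)

lemma chirality_uminus: "chirality w (map uminus s) = chirality w s"
proof -
  have "occurrences v (map uminus s) = occurrences (map uminus v) s" for v
    using occurrences_map[of uminus "map uminus v" s] by (simp add: o_def)
  then show ?thesis by (simp add: chirality_def rev_map o_def)
qed

lemma chirality_append:
  "\<bar>chirality w (u @ v) - chirality w u - chirality w v\<bar> \<le> 2 * int (length w)"
proof (cases "w = []")
  case False
  then show ?thesis
    using occurrences_append[of w u v] occurrences_append[of "map uminus w" u v]
      occurrences_append[of "rev w" u v] occurrences_append[of "rev (map uminus w)" u v]
    by (simp add: chirality_def)
qed (simp add: chirality_def)

lemma chirality_cancel_palindrome:
  assumes "rev (p @ x) = p @ x"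
  shows "\<bar>chirality w (p @ q) - chirality w (map uminus (rev x) @ q)\<bar> \<le> 6 * int (length w)"
proof -
  have "chirality w (p @ x) = 0"
    using chirality_rev[of w "p @ x"] assms by simp
  moreover have "chirality w (map uminus (rev x)) = - chirality w x"
    by (simp only: chirality_uminus chirality_rev)
  ultimately show ?thesis
    using chirality_append[of w p x] chirality_append[of w p q]
      chirality_append[of w "map uminus (rev x)" q]
    by linarith
qed

definition chiral_word :: "int list" where
  "chiral_word = [1, -1, -1, 1, 1]"

text \<open>
  Up to a global sign, \<open>chiral_word\<close> occurs wherever a run of length \<open>2\<close> is preceded by some run and
  followed by one of length at least \<open>2\<close>; for its reversal the two neighbours are exchanged. The
  runs in a power of \<open>chiral_block\<close> have the lengths \<open>1, 2, 3, 1, 1, 2, 3, 1, \<dots>\<close>.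
\<close>

definition chiral_block :: "int list" where
  "chiral_block = [1, -1, -1, 1, 1, 1, -1]"

lemma chirality_block_power:
  "chirality chiral_word (concat (replicate n chiral_block)) = int n"
proof (induction n rule: induct_nat_012)
  case (ge2 n)
  have "chirality chiral_word (chiral_block @ chiral_block @ s) =
      1 + chirality chiral_word (chiral_block @ s)" for s
    by (simp add: chirality_def chiral_word_def chiral_block_def)
  with ge2 show ?case by simp
qed (simp_all add: chirality_def chiral_word_def chiral_block_def)

section \<open>Coset representatives\<close>

context group
begin

lemma subgroup_mult_left_iff:
  assumes "subgroup H G" "h \<in> H" "g \<in> carrier G"
  shows "h \<otimes> g \<in> H \<longleftrightarrow> g \<in> H"
proof -
  interpret H: subgroup H G by fact
  have "g = inv h \<otimes> (h \<otimes> g)" using assms by (simp add: m_assoc[symmetric])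
  then show ?thesis using assms by (metis H.m_closed H.m_inv_closed)
qed

lemma lcoset_meets_subgroup:
  assumes "subgroup H G" "h \<in> carrier G" "k \<in> h <# H" "k \<in> H"
  shows "h \<in> H"
proof -
  have "h \<otimes> \<one> \<in> h <# H"
    using subgroup.one_closed[OF assms(1)] by (auto simp: l_coset_def)
  also have "h <# H = k <# H"
    using assms by (intro l_repr_independence)
  also have "\<dots> = H"
    using assms by (intro coset_join3) (auto dest: subgroup.mem_carrier)
  finally show ?thesis using assms(2) by simp
qed

definition coset_rep :: "'a set \<Rightarrow> 'a \<Rightarrow> 'a" where
  "coset_rep H g = (if g \<in> H then \<one> else SOME r. r \<in> H #> g)"

context
  fixes H g
  assumes H: "subgroup H G" and g: "g \<in> carrier G"
begin

lemma coset_rep_in_coset: "coset_rep H g \<in> H #> g"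
proof (cases "g \<in> H")
  case True
  then show ?thesis
    using coset_join2[OF g H] subgroup.one_closed[OF H] by (simp add: coset_rep_def)
next
  case False
  then show ?thesis
    using someI[of "\<lambda>r. r \<in> H #> g", OF rcos_self[OF g H]] by (simp add: coset_rep_def)
qed

lemma coset_rep_carrier: "coset_rep H g \<in> carrier G"
  using subgroup.elemrcos_carrier[OF H is_group g coset_rep_in_coset] .

lemma coset_coset_rep: "H #> coset_rep H g = H #> g"
  using repr_independence[OF coset_rep_in_coset g H] by simp

lemma coset_rep_quotient: "g \<otimes> inv (coset_rep H g) \<in> H"
  using rcos_self[OF g H] coset_coset_rep
  by (intro subgroup.rcos_module_imp[OF H is_group coset_rep_carrier]) simp

lemma coset_rep_decomp: "g \<otimes> inv (coset_rep H g) \<otimes> coset_rep H g = g"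
  using g coset_rep_carrier by (simp add: m_assoc)

lemma coset_rep_eq_one_iff: "coset_rep H g = \<one> \<longleftrightarrow> g \<in> H"
  using coset_rep_quotient g by (auto simp: coset_rep_def)

end

lemma coset_rep_cong:
  assumes "subgroup H G" "g \<in> carrier G" "g' \<in> carrier G" "H #> g = H #> g'"
  shows "coset_rep H g = coset_rep H g'"
proof -
  have "g \<in> H \<longleftrightarrow> g' \<in> H"
    using assms coset_join1 coset_join2 by metis
  then show ?thesis using assms(4) by (simp add: coset_rep_def)
qed

lemma coset_rep_idem:
  assumes "subgroup H G" "g \<in> carrier G"
  shows "coset_rep H (coset_rep H g) = coset_rep H g"
  using assms by (intro coset_rep_cong coset_rep_carrier coset_coset_rep)

lemma coset_rep_mult_left:
  assumes "subgroup H G" "h \<in> H" "g \<in> carrier G"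
  shows "coset_rep H (h \<otimes> g) = coset_rep H g"
proof (rule coset_rep_cong)
  have "h \<in> carrier G" "H \<subseteq> carrier G"
    using assms(1,2) by (auto dest: subgroup.subset)
  then show "h \<otimes> g \<in> carrier G" "H #> (h \<otimes> g) = H #> g"
    using assms coset_join2[of h H] coset_mult_assoc[of H h g] by simp_all
qed (use assms in auto)

end

section \<open>The action on normal forms\<close>

type_synonym 'a hnn_state = "'a \<times> (int \<times> 'a) list"

definition exponents :: "'a hnn_state \<Rightarrow> int list" where
  "exponents s = map fst (snd s)"

locale hnn_data = group G for G :: "('a, 'b) monoid_scheme" (structure) +
  fixes A B :: "'a set" and \<phi> :: "'a \<Rightarrow> 'a"
  assumes subgroup_A: "subgroup A G" and subgroup_B: "subgroup B G"
    and \<phi>_iso: "\<phi> \<in> iso (G\<lparr>carrier := A\<rparr>) (G\<lparr>carrier := B\<rparr>)"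
begin

text \<open>
  The elements \<open>d\<close> of \<open>edge_subgroup e\<close> can be moved to the left across \<open>t\<^sup>e\<close>, by the relation
  \<open>t\<^sup>e d = edge_map e d t\<^sup>e\<close>.
\<close>

definition edge_subgroup :: "int \<Rightarrow> 'a set" where
  "edge_subgroup e = (if e = 1 then B else A)"

definition edge_map :: "int \<Rightarrow> 'a \<Rightarrow> 'a" where
  "edge_map e = (if e = 1 then inv_into A \<phi> else \<phi>)"

lemma subgroup_edge: "subgroup (edge_subgroup e) G"
  by (simp add: edge_subgroup_def subgroup_A subgroup_B)

lemma edge_carrier: "d \<in> edge_subgroup e \<Longrightarrow> d \<in> carrier G"
  using subgroup_edge by (rule subgroup.mem_carrier)

lemma edge_map_iso:
  assumes "e \<in> {1, -1}"
  shows "edge_map e \<in> iso (G\<lparr>carrier := edge_subgroup e\<rparr>) (G\<lparr>carrier := edge_subgroup (- e)\<rparr>)"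
  using assms \<phi>_iso
    group.iso_set_sym[OF subgroup.subgroup_is_group[OF subgroup_A is_group] \<phi>_iso]
  by (auto simp: edge_subgroup_def edge_map_def)

lemma edge_map_closed:
  "e \<in> {1, -1} \<Longrightarrow> d \<in> edge_subgroup e \<Longrightarrow> edge_map e d \<in> edge_subgroup (- e)"
  using hom_in_carrier[OF iso_imp_homomorphism[OF edge_map_iso]] by simp

lemma edge_map_carrier: "e \<in> {1, -1} \<Longrightarrow> d \<in> edge_subgroup e \<Longrightarrow> edge_map e d \<in> carrier G"
  using edge_map_closed edge_carrier by blast

lemma edge_map_mult:
  assumes "e \<in> {1, -1}" "d \<in> edge_subgroup e" "d' \<in> edge_subgroup e"
  shows "edge_map e (d \<otimes> d') = edge_map e d \<otimes> edge_map e d'"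
  using hom_mult[OF iso_imp_homomorphism[OF edge_map_iso[OF assms(1)]]] assms(2,3) by simp

lemma edge_map_inverse:
  assumes "e \<in> {1, -1}" "d \<in> edge_subgroup e"
  shows "edge_map (- e) (edge_map e d) = d"
proof -
  have "bij_betw \<phi> A B" using \<phi>_iso by (simp add: iso_def)
  then show ?thesis
    using assms bij_betw_inv_into_left[of \<phi> A B] bij_betw_inv_into_right[of \<phi> A B]
    by (auto simp: edge_subgroup_def edge_map_def)
qed

text \<open>
  The normal form \<open>(g, [(e\<^sub>1, r\<^sub>1), \<dots>, (e\<^sub>n, r\<^sub>n)])\<close> stands for the element
  \<open>g t\<^bsup>e\<^sub>1\<^esup> r\<^sub>1 \<dots> t\<^bsup>e\<^sub>n\<^esup> r\<^sub>n\<close>.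
\<close>

fun normal_tail :: "(int \<times> 'a) list \<Rightarrow> bool" where
  "normal_tail [] \<longleftrightarrow> True"
| "normal_tail ((e, r) # l) \<longleftrightarrow>
    e \<in> {1, -1} \<and> r \<in> carrier G \<and> coset_rep (edge_subgroup e) r = r \<and>
    (r = \<one> \<longrightarrow> l = [] \<or> fst (hd l) \<noteq> - e) \<and> normal_tail l"

definition normal_form :: "'a hnn_state \<Rightarrow> bool" where
  "normal_form s \<longleftrightarrow> fst s \<in> carrier G \<and> normal_tail (snd s)"

definition base_act :: "'a \<Rightarrow> 'a hnn_state \<Rightarrow> 'a hnn_state" where
  "base_act h s = (h \<otimes> fst s, snd s)"

definition cancellable :: "int \<Rightarrow> 'a hnn_state \<Rightarrow> bool" where
  "cancellable e s \<longleftrightarrow> fst s \<in> edge_subgroup e \<and> snd s \<noteq> [] \<and> fst (hd (snd s)) = - e"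

definition stable_act :: "int \<Rightarrow> 'a hnn_state \<Rightarrow> 'a hnn_state" where
  "stable_act e s = (let (g, l) = s; r = coset_rep (edge_subgroup e) g in
    if cancellable e s then (edge_map e g \<otimes> snd (hd l), tl l)
    else (edge_map e (g \<otimes> inv r), (e, r) # l))"

primrec letter_act :: "'a hnn_letter \<Rightarrow> 'a hnn_state \<Rightarrow> 'a hnn_state" where
  "letter_act (Base g) = base_act g"
| "letter_act (Stable e) = stable_act e"

definition word_act :: "'a hnn_letter list \<Rightarrow> 'a hnn_state \<Rightarrow> 'a hnn_state" where
  "word_act = foldr letter_act"

lemma word_act_simps [simp]:
  "word_act [] s = s"
  "word_act (x # w) s = letter_act x (word_act w s)"
  "word_act (u @ v) s = word_act u (word_act v s)"
  by (simp_all add: word_act_def)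

lemma stable_act_cancel:
  "g \<in> edge_subgroup e \<Longrightarrow> stable_act e (g, (- e, r) # l) = (edge_map e g \<otimes> r, l)"
  by (simp add: stable_act_def cancellable_def)

lemma stable_act_extend:
  "\<not> cancellable e (g, l) \<Longrightarrow> stable_act e (g, l) =
    (edge_map e (g \<otimes> inv (coset_rep (edge_subgroup e) g)), (e, coset_rep (edge_subgroup e) g) # l)"
  by (simp add: stable_act_def Let_def)

lemma cancellable_cases:
  obtains (cancel) g r l where "s = (g, (- e, r) # l)" "g \<in> edge_subgroup e"
  | (extend) g l where "s = (g, l)" "\<not> cancellable e (g, l)"
proof (cases "cancellable e s")
  case True
  then show ?thesis
    using cancel[of "fst s" "snd (hd (snd s))" "tl (snd s)"]
    by (cases "snd s") (auto simp: cancellable_def prod_eq_iff)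
next
  case False
  then show ?thesis using extend[of "fst s" "snd s"] by simp
qed

lemma normal_form_one: "normal_form (\<one>, [])"
  by (simp add: normal_form_def)

lemma normal_form_base_act:
  "h \<in> carrier G \<Longrightarrow> normal_form s \<Longrightarrow> normal_form (base_act h s)"
  by (simp add: normal_form_def base_act_def)

lemma normal_form_stable_act:
  assumes e: "e \<in> {1, -1}" and s: "normal_form s"
  shows "normal_form (stable_act e s)"
proof (cases rule: cancellable_cases[of s e])
  case (cancel g r l)
  then show ?thesis
    using s edge_map_carrier[OF e] by (simp add: normal_form_def stable_act_cancel)
next
  case (extend g l)
  then have g: "g \<in> carrier G" using s by (simp add: normal_form_def)
  show ?thesis
    using s e extend edge_map_carrier[OF e coset_rep_quotient[OF subgroup_edge g]]
    by (auto simp: stable_act_extend normal_form_def cancellable_def subgroup_edge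
        coset_rep_carrier coset_rep_idem coset_rep_eq_one_iff)
qed

lemma normal_form_word_act:
  "w \<in> hnn_words G \<Longrightarrow> normal_form s \<Longrightarrow> normal_form (word_act w s)"
proof (induction w)
  case (Cons x w)
  then have "normal_form (word_act w s)" and "x \<in> Base ` carrier G \<union> Stable ` {1, -1}"
    by (auto simp: hnn_words_def)
  then show ?case
    using normal_form_base_act normal_form_stable_act by (elim UnE imageE) simp_all
qed simp

lemma stable_act_inverse:
  assumes e: "e \<in> {1, -1}" and s: "normal_form s"
  shows "stable_act (- e) (stable_act e s) = s"
proof (cases rule: cancellable_cases[of s e])
  case (cancel g r l)
  have r: "r \<in> carrier G" "coset_rep (edge_subgroup (- e)) r = r"
    "r = \<one> \<longrightarrow> l = [] \<or> fst (hd l) \<noteq> e"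
    using s cancel(1) by (auto simp: normal_form_def)
  note d = edge_map_closed[OF e cancel(2)] edge_map_carrier[OF e cancel(2)]
  have rep: "coset_rep (edge_subgroup (- e)) (edge_map e g \<otimes> r) = r"
    using coset_rep_mult_left[OF subgroup_edge d(1) r(1)] r(2) by simp
  have "edge_map e g \<otimes> r \<in> edge_subgroup (- e) \<longleftrightarrow> r = \<one>"
    using coset_rep_eq_one_iff[OF subgroup_edge, of "edge_map e g \<otimes> r" "- e"] rep d(2) r(1) by auto
  then have "\<not> cancellable (- e) (edge_map e g \<otimes> r, l)"
    using r(3) by (auto simp: cancellable_def)
  then have "stable_act (- e) (edge_map e g \<otimes> r, l) =
      (edge_map (- e) (edge_map e g \<otimes> r \<otimes> inv r), (- e, r) # l)"
    by (simp add: stable_act_extend rep)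
  also have "edge_map e g \<otimes> r \<otimes> inv r = edge_map e g"
    using d(2) r(1) by (simp add: m_assoc)
  finally show ?thesis
    by (simp add: cancel stable_act_cancel edge_map_inverse[OF e])
next
  case (extend g l)
  have g: "g \<in> carrier G" using s extend(1) by (simp add: normal_form_def)
  note quotient = coset_rep_quotient[OF subgroup_edge g, of e]
  have "stable_act (- e) (stable_act e s) = (edge_map (- e) (edge_map e
      (g \<otimes> inv (coset_rep (edge_subgroup e) g))) \<otimes> coset_rep (edge_subgroup e) g, l)"
    using extend stable_act_cancel[OF edge_map_closed[OF e quotient]]
    by (simp add: stable_act_extend)
  then show ?thesis
    by (simp only: edge_map_inverse[OF e quotient] coset_rep_decomp[OF subgroup_edge g] extend(1))
qed

lemma stable_act_base_act:
  assumes e: "e \<in> {1, -1}" and d: "d \<in> edge_subgroup e" and s: "normal_form s"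
  shows "stable_act e (base_act d s) = base_act (edge_map e d) (stable_act e s)"
proof (cases rule: cancellable_cases[of s e])
  case (cancel g r l)
  then have "r \<in> carrier G" using s by (simp add: normal_form_def)
  then show ?thesis
    using cancel subgroup.m_closed[OF subgroup_edge d] edge_map_carrier[OF e]
      edge_map_mult[OF e d] d
    by (simp add: base_act_def stable_act_cancel m_assoc)
next
  case (extend g l)
  have g: "g \<in> carrier G" using s extend(1) by (simp add: normal_form_def)
  have "\<not> cancellable e (d \<otimes> g, l)"
    using extend(2) subgroup_mult_left_iff[OF subgroup_edge d g] by (simp add: cancellable_def)
  moreover have "edge_map e (d \<otimes> g \<otimes> inv (coset_rep (edge_subgroup e) g)) =
      edge_map e d \<otimes> edge_map e (g \<otimes> inv (coset_rep (edge_subgroup e) g))"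
    using edge_map_mult[OF e d coset_rep_quotient[OF subgroup_edge g]] edge_carrier[OF d] g
      coset_rep_carrier[OF subgroup_edge g]
    by (simp add: m_assoc)
  ultimately show ?thesis
    using extend coset_rep_mult_left[OF subgroup_edge d g]
    by (simp add: base_act_def stable_act_extend)
qed

lemma \<phi>_image: "\<phi> ` A \<subseteq> carrier G"
  using edge_map_carrier[of "-1"] by (auto simp: edge_map_def edge_subgroup_def)

lemma word_act_hnn_eq:
  "hnn_eq G A \<phi> u v \<Longrightarrow> normal_form s \<Longrightarrow> word_act u s = word_act v s"
proof (induction arbitrary: s rule: hnn_eq.induct)
  case (append u u' v v')
  then show ?case using normal_form_word_act hnn_eq_words[OF is_group subgroup_A \<phi>_image] by simp
next
  case (mult g h)
  then show ?case by (simp add: normal_form_def base_act_def m_assoc)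
next
  case one
  then show ?case by (simp add: normal_form_def base_act_def)
next
  case (cancel e)
  then have "- e \<in> {1, -1}" by auto
  then show ?case using stable_act_inverse[of "- e" s] cancel.prems by simp
next
  case (conj a)
  then have "stable_act (-1) (base_act a (stable_act 1 s)) =
      base_act (\<phi> a) (stable_act (-1) (stable_act 1 s))"
    using stable_act_base_act[of "-1" a "stable_act 1 s"] normal_form_stable_act[of 1 s]
    by (simp add: edge_map_def edge_subgroup_def)
  then show ?case using stable_act_inverse[of 1 s] conj.prems by simp
qed simp_all

section \<open>Britton's lemma\<close>

lemma hnn_reduced_Cons:
  "hnn_reduced G A B (g # h # gs) (e # es) \<longleftrightarrow>
    g \<in> carrier G \<and> e \<in> {1, -1} \<and> \<not> (h \<in> edge_subgroup e \<and> es \<noteq> [] \<and> hd es = - e) \<and>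
    hnn_reduced G A B (h # gs) es"
proof (cases es)
  case (Cons f es')
  then show ?thesis
    by (auto simp: hnn_reduced_def edge_subgroup_def All_less_Suc2)
qed (auto simp: hnn_reduced_def)

lemma hnn_reduced_induct [consumes 1, case_names Base Stable]:
  assumes "hnn_reduced G A B gs es"
    and Base: "\<And>g. g \<in> carrier G \<Longrightarrow> P [g] []"
    and Stable: "\<And>g h gs e es. g \<in> carrier G \<Longrightarrow> e \<in> {1, -1} \<Longrightarrow>
      \<not> (h \<in> edge_subgroup e \<and> es \<noteq> [] \<and> hd es = - e) \<Longrightarrow>
      hnn_reduced G A B (h # gs) es \<Longrightarrow> P (h # gs) es \<Longrightarrow> P (g # h # gs) (e # es)"
  shows "P gs es"
  using assms(1)
proof (induction es arbitrary: gs)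
  case Nil
  then obtain g where "gs = [g]" "g \<in> carrier G"
    by (auto simp: hnn_reduced_def length_Suc_conv)
  then show ?case using Base by simp
next
  case (Cons e es)
  then obtain g h gs' where gs: "gs = g # h # gs'"
    by (auto simp: hnn_reduced_def length_Suc_conv)
  with Cons show ?case using Stable by (simp add: hnn_reduced_Cons)
qed

lemma hnn_word_singleton: "hnn_word [g] [] = [Base g]"
  by (simp add: hnn_word_def)

lemma hnn_word_Cons:
  "hnn_word (g # h # gs) (e # es) = Base g # Stable e # hnn_word (h # gs) es"
  by (simp add: hnn_word_def)

lemma hnn_word_in_words: "hnn_reduced G A B gs es \<Longrightarrow> hnn_word gs es \<in> hnn_words G"
  by (induction rule: hnn_reduced_induct)
    (auto simp: hnn_words_def hnn_word_singleton hnn_word_Cons)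

text \<open>
  The last conjunct drives the induction: the leading base element of the result still lies in the
  coset of the first letter \<open>g\<close>, so a further stable letter cancels against the result only if the
  extended word is not reduced.
\<close>

definition britton_product :: "'a \<Rightarrow> int list \<Rightarrow> 'a hnn_state \<Rightarrow> 'a hnn_state \<Rightarrow> bool" where
  "britton_product g es s s' \<longleftrightarrow> (\<exists>p x q.
    es = p @ x \<and> exponents s = map uminus (rev x) @ q \<and> exponents s' = p @ q \<and>
    (p \<noteq> [] \<longrightarrow> fst s' \<in> g <# edge_subgroup (- hd p)))"

lemma britton_product_Base: "britton_product g [] s (base_act g s)"
  by (simp add: britton_product_def base_act_def exponents_def)

lemma britton_product_Stable:
  assumes product: "britton_product h es s s'" and s': "normal_form s'"
    and h: "h \<in> carrier G" and e: "e \<in> {1, -1}"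
    and reduced: "\<not> (h \<in> edge_subgroup e \<and> es \<noteq> [] \<and> hd es = - e)"
  shows "britton_product g (e # es) s (base_act g (stable_act e s'))"
proof -
  obtain p x q where split: "es = p @ x" "exponents s = map uminus (rev x) @ q"
    "exponents s' = p @ q" and coset: "p \<noteq> [] \<Longrightarrow> fst s' \<in> h <# edge_subgroup (- hd p)"
    using product by (auto simp: britton_product_def)
  show ?thesis
  proof (cases rule: cancellable_cases[of s' e])
    case (cancel k r l)
    have "p = []"
    proof (rule ccontr)
      assume p: "p \<noteq> []"
      then have "hd p = - e"
        using split(3) cancel(1) by (cases p) (auto simp: exponents_def)
      then have "h \<in> edge_subgroup e"
        using lcoset_meets_subgroup[OF subgroup_edge h] coset[OF p] cancel by simp
      with reduced \<open>hd p = - e\<close> p split(1) show False by simp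
    qed
    then have "exponents s = map uminus (rev (e # es)) @ map fst l"
      using split cancel(1) by (auto simp: exponents_def)
    then show ?thesis
      using cancel unfolding britton_product_def
      by (intro exI[of _ "[]"] exI[of _ "e # es"] exI[of _ "map fst l"])
        (simp add: stable_act_cancel base_act_def exponents_def)
  next
    case (extend k l)
    have "k \<in> carrier G" using s' extend(1) by (simp add: normal_form_def)
    then have "edge_map e (k \<otimes> inv (coset_rep (edge_subgroup e) k)) \<in> edge_subgroup (- e)"
      by (intro edge_map_closed[OF e] coset_rep_quotient subgroup_edge)
    then show ?thesis
      using split extend unfolding britton_product_def
      by (intro exI[of _ "e # p"] exI[of _ x] exI[of _ q])
        (auto simp: stable_act_extend base_act_def exponents_def l_coset_def)
  qed
qed

lemma britton_product_hnn_word: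
  assumes "hnn_reduced G A B gs es" "normal_form s"
  shows "britton_product (hd gs) es s (word_act (hnn_word gs es) s)"
  using assms(1)
proof (induction rule: hnn_reduced_induct)
  case (Base g)
  then show ?case using britton_product_Base by (simp add: hnn_word_singleton)
next
  case (Stable g h gs e es)
  have "normal_form (word_act (hnn_word (h # gs) es) s)"
    using Stable.hyps assms(2) by (intro normal_form_word_act hnn_word_in_words)
  moreover have "h \<in> carrier G" using Stable.hyps by (simp add: hnn_reduced_def)
  ultimately show ?case
    using Stable britton_product_Stable by (simp add: hnn_word_Cons)
qed

lemma exponents_reduced_word:
  assumes "hnn_reduced G A B gs es"
  shows "exponents (word_act (hnn_word gs es) (\<one>, [])) = es"
  using britton_product_hnn_word[OF assms normal_form_one]
  by (auto simp: britton_product_def exponents_def)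

lemma ex_reduced:
  assumes "A \<noteq> carrier G" "B \<noteq> carrier G" "set es \<subseteq> {1, -1}"
  shows "\<exists>gs. hnn_reduced G A B gs es"
proof -
  obtain a b where "a \<in> carrier G" "a \<notin> A" "b \<in> carrier G" "b \<notin> B"
    using assms(1,2) subgroup.subset[OF subgroup_A] subgroup.subset[OF subgroup_B] by blast
  then have "hnn_reduced G A B (\<one> # map (\<lambda>e. if e = 1 then b else a) es) es"
    unfolding hnn_reduced_def using assms(3) by auto
  then show ?thesis ..
qed

section \<open>Palindromic length\<close>

abbreviation extension :: "'a hnn_letter list set monoid" where
  "extension \<equiv> hnn_extension G A \<phi>"

abbreviation word_class :: "'a hnn_letter list \<Rightarrow> 'a hnn_letter list set" where
  "word_class \<equiv> hnn_class G A \<phi>"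

abbreviation palindromes :: "'a hnn_letter list set set" where
  "palindromes \<equiv> hnn_palindromes G A B \<phi>"

lemma word_class_in_carrier: "w \<in> hnn_words G \<Longrightarrow> word_class w \<in> carrier extension"
  by (simp add: hnn_extension_def)

lemma palindrome_in_carrier: "p \<in> palindromes \<Longrightarrow> p \<in> carrier extension"
  by (auto simp: hnn_palindromes_def intro: word_class_in_carrier hnn_word_in_words)

lemma abs_le_palindromic_length:
  fixes f :: "'a hnn_letter list set \<Rightarrow> int" and c :: int
  assumes one: "f \<one>\<^bsub>extension\<^esub> = 0"
    and mult: "\<And>p x. p \<in> palindromes \<Longrightarrow> x \<in> carrier extension \<Longrightarrow>
      \<bar>f (p \<otimes>\<^bsub>extension\<^esub> x) - f x\<bar> \<le> c"
    and x: "x \<in> carrier extension"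
  shows "\<bar>f x\<bar> \<le> c * int (hnn_palindromic_length G A B \<phi> x)"
proof -
  interpret E: group extension
    by (rule group_hnn_extension[OF is_group subgroup_A \<phi>_image])
  let ?product = "\<lambda>ps. foldr (\<lambda>p q. p \<otimes>\<^bsub>extension\<^esub> q) ps \<one>\<^bsub>extension\<^esub>"
  have "?product ps \<in> carrier extension \<and> \<bar>f (?product ps)\<bar> \<le> c * int (length ps)"
    if "set ps \<subseteq> palindromes" for ps
    using that
  proof (induction ps)
    case (Cons p ps)
    then show ?case
      using mult[of p "?product ps"] palindrome_in_carrier[of p] by (auto simp: distrib_left)
  qed (simp add: one)
  moreover obtain ps where "length ps = hnn_palindromic_length G A B \<phi> x"
    "set ps \<subseteq> palindromes" "x = ?product ps"
    using LeastI_ex[OF hnn_palindromic_length_exists[OF is_group subgroup_A \<phi>_image x]]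
    unfolding hnn_palindromic_length_def by blast
  ultimately show ?thesis by metis
qed

definition element_exponents :: "'a hnn_letter list set \<Rightarrow> int list" where
  "element_exponents x = exponents (word_act (SOME w. w \<in> x) (\<one>, []))"

lemma element_exponents_word_class:
  assumes "w \<in> hnn_words G"
  shows "element_exponents (word_class w) = exponents (word_act w (\<one>, []))"
proof -
  have "hnn_eq G A \<phi> w (SOME v. v \<in> word_class w)"
    using hnn_eq.refl[OF assms] someI[of "\<lambda>v. v \<in> word_class w" w] by (simp add: hnn_class_def)
  then show ?thesis
    using word_act_hnn_eq normal_form_one by (simp add: element_exponents_def)
qed

lemma ex_element_exponents:
  assumes "A \<noteq> carrier G" "B \<noteq> carrier G" "set es \<subseteq> {1, -1}"
  obtains x where "x \<in> carrier extension" "element_exponents x = es"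
proof -
  obtain gs where "hnn_reduced G A B gs es" using ex_reduced[OF assms] ..
  then show thesis
    using that[of "word_class (hnn_word gs es)"] word_class_in_carrier hnn_word_in_words
    by (simp add: element_exponents_word_class exponents_reduced_word)
qed

lemma chirality_palindrome_mult:
  assumes "p \<in> palindromes" "x \<in> carrier extension"
  shows "\<bar>chirality w (element_exponents (p \<otimes>\<^bsub>extension\<^esub> x)) - chirality w (element_exponents x)\<bar>
    \<le> 6 * int (length w)"
proof -
  obtain gs es where p: "p = word_class (hnn_word gs es)" "hnn_reduced G A B gs es" "rev es = es"
    using assms(1) by (auto simp: hnn_palindromes_def)
  obtain u where u: "u \<in> hnn_words G" "x = word_class u"
    using assms(2) by (auto simp: hnn_extension_def)
  define s where "s = word_act u (\<one>, [])"
  have "normal_form s" using u(1) normal_form_one by (simp add: s_def normal_form_word_act)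
  then obtain a b c where split: "es = a @ b" "exponents s = map uminus (rev b) @ c"
    "exponents (word_act (hnn_word gs es) s) = a @ c"
    using britton_product_hnn_word[OF p(2)] unfolding britton_product_def by blast
  note words = hnn_word_in_words[OF p(2)] u(1)
  have "p \<otimes>\<^bsub>extension\<^esub> x = word_class (hnn_word gs es @ u)"
    unfolding p(1) u(2) by (rule hnn_mult_class[OF is_group subgroup_A \<phi>_image words])
  then have "element_exponents (p \<otimes>\<^bsub>extension\<^esub> x) = a @ c"
    using words split(3)
    by (simp add: element_exponents_word_class s_def
        hnn_words_append[OF is_group subgroup_A \<phi>_image])
  moreover have "element_exponents x = map uminus (rev b) @ c"
    using u split(2) by (simp add: element_exponents_word_class s_def)
  ultimately show ?thesis
    using chirality_cancel_palindrome[of a b w c] p(3) split(1) by simp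
qed

lemma chirality_le_palindromic_length:
  assumes "x \<in> carrier extension"
  shows "\<bar>chirality w (element_exponents x)\<bar>
    \<le> 6 * int (length w) * int (hnn_palindromic_length G A B \<phi> x)"
proof (rule abs_le_palindromic_length[OF _ chirality_palindrome_mult assms])
  have "element_exponents (word_class []) = []"
    by (subst element_exponents_word_class) (simp_all add: hnn_words_def exponents_def)
  then show "chirality w (element_exponents \<one>\<^bsub>extension\<^esub>) = 0"
    by (simp add: hnn_extension_def)
qed

lemma palindromic_width_infinite:
  assumes "A \<noteq> carrier G" "B \<noteq> carrier G"
  shows "hnn_palindromic_width G A B \<phi> = \<infinity>"
proof (rule ccontr)
  assume "hnn_palindromic_width G A B \<phi> \<noteq> \<infinity>"
  then obtain N where N: "hnn_palindromic_width G A B \<phi> = enat N" by auto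
  define C where "C = 6 * length chiral_word"
  define es where "es = concat (replicate (Suc (C * N)) chiral_block)"
  have "set es \<subseteq> {1, -1}" by (auto simp: es_def chiral_block_def)
  then obtain x where x: "x \<in> carrier extension" "element_exponents x = es"
    using ex_element_exponents assms by blast
  have "int (Suc (C * N)) = chirality chiral_word (element_exponents x)"
    unfolding x(2) es_def by (rule chirality_block_power[symmetric])
  also have "\<dots> \<le> int (C * hnn_palindromic_length G A B \<phi> x)"
    using chirality_le_palindromic_length[OF x(1), of chiral_word] by (simp add: C_def)
  finally have "C * N < C * hnn_palindromic_length G A B \<phi> x"
    by (simp only: of_nat_le_iff Suc_le_eq)
  then have "N < hnn_palindromic_length G A B \<phi> x" by simp
  moreover have "enat (hnn_palindromic_length G A B \<phi> x) \<le> enat N"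
    unfolding N[symmetric] hnn_palindromic_width_def using x(1) by (rule SUP_upper)
  ultimately show False by simp
qed

end

theorem theorem1p1:
  fixes G :: "('a, 'b) monoid_scheme" and A B :: "'a set" and \<phi> :: "'a \<Rightarrow> 'a"
  assumes "group G"
    and "subgroup A G" and "A \<noteq> carrier G"
    and "subgroup B G" and "B \<noteq> carrier G"
    and "\<phi> \<in> iso (G\<lparr>carrier := A\<rparr>) (G\<lparr>carrier := B\<rparr>)"
  shows "hnn_palindromic_width G A B \<phi> = \<infinity>"
proof -
  interpret hnn_data G A B \<phi>
    using assms by (simp add: hnn_data_def hnn_data_axioms_def)
  show ?thesis using assms(3,5) by (rule palindromic_width_infinite)
qed

end
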